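(* Let $\mathfrak B$ be a Boolean algebra freely generated by $\mathcal G=\{A_1,A_2,A_3\}$, and let $\mathfrak B_{13}$ and $\mathfrak B_{23}$ be the subalgebras generated respectively by $\{A_1,A_3\}$ and $\{A_2,A_3\}$. Consider a function $f:\mathfrak B_{13}\cup\mathfrak B_{23}\to[0,1]$ such that $f|_{\mathfrak B_{13}}$ and $f|_{\mathfrak B_{23}}$ are normalized measures on these subalgebras. Then $f$ is extensible to a normalized measure on the algebra $\mathfrak B$.
   Context: A normalized measure on a Boolean algebra is a non-negative real function, additive on disjoint elements, taking the value $1$ on the unit. *)

theory Defs
  imports Complex_Main "HOL-Library.FuncSet" "HOL.Hull"
begin

definition boolean_subalgebra :: "'a::boolean_algebra set \<Rightarrow> bool" where
  "boolean_subalgebra S \<longleftrightarrow>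
     bot \<in> S \<and> top \<in> S \<and> (\<forall>x\<in>S. - x \<in> S) \<and>
     (\<forall>x\<in>S. \<forall>y\<in>S. inf x y \<in> S \<and> sup x y \<in> S)"

abbreviation generated_subalgebra :: "'a::boolean_algebra set \<Rightarrow> 'a set" where
  "generated_subalgebra G \<equiv> boolean_subalgebra hull G"

(* The axioms of the library locale abstract_boolean_algebra, relativised to a carrier set;
   the library version is restricted to algebras filling a whole type. *)
locale boolean_algebra_on =
  fixes C :: "'c set"
    and meet :: "'c \<Rightarrow> 'c \<Rightarrow> 'c" and join :: "'c \<Rightarrow> 'c \<Rightarrow> 'c"
    and compl :: "'c \<Rightarrow> 'c" and zero :: 'c and one :: 'c
  assumes meet_closed: "x \<in> C \<Longrightarrow> y \<in> C \<Longrightarrow> meet x y \<in> C"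
    and join_closed: "x \<in> C \<Longrightarrow> y \<in> C \<Longrightarrow> join x y \<in> C"
    and compl_closed: "x \<in> C \<Longrightarrow> compl x \<in> C"
    and zero_closed: "zero \<in> C"
    and one_closed: "one \<in> C"
    and meet_assoc: "x \<in> C \<Longrightarrow> y \<in> C \<Longrightarrow> z \<in> C \<Longrightarrow> meet (meet x y) z = meet x (meet y z)"
    and join_assoc: "x \<in> C \<Longrightarrow> y \<in> C \<Longrightarrow> z \<in> C \<Longrightarrow> join (join x y) z = join x (join y z)"
    and meet_commute: "x \<in> C \<Longrightarrow> y \<in> C \<Longrightarrow> meet x y = meet y x"
    and join_commute: "x \<in> C \<Longrightarrow> y \<in> C \<Longrightarrow> join x y = join y x"
    and meet_join_distrib:
      "x \<in> C \<Longrightarrow> y \<in> C \<Longrightarrow> z \<in> C \<Longrightarrow> meet x (join y z) = join (meet x y) (meet x z)"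
    and join_meet_distrib:
      "x \<in> C \<Longrightarrow> y \<in> C \<Longrightarrow> z \<in> C \<Longrightarrow> join x (meet y z) = meet (join x y) (join x z)"
    and meet_one: "x \<in> C \<Longrightarrow> meet x one = x"
    and join_zero: "x \<in> C \<Longrightarrow> join x zero = x"
    and meet_compl: "x \<in> C \<Longrightarrow> meet x (compl x) = zero"
    and join_compl: "x \<in> C \<Longrightarrow> join x (compl x) = one"

definition boolean_hom_into ::
    "('c \<Rightarrow> 'c \<Rightarrow> 'c) \<Rightarrow> ('c \<Rightarrow> 'c \<Rightarrow> 'c) \<Rightarrow> ('c \<Rightarrow> 'c) \<Rightarrow> 'c \<Rightarrow> 'c
      \<Rightarrow> ('a::boolean_algebra \<Rightarrow> 'c) \<Rightarrow> bool" where
  "boolean_hom_into meet join compl zero one h \<longleftrightarrow>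
     (\<forall>x y. h (inf x y) = meet (h x) (h y)) \<and>
     (\<forall>x y. h (sup x y) = join (h x) (h y)) \<and>
     (\<forall>x. h (- x) = compl (h x)) \<and>
     h bot = zero \<and> h top = one"

(* The universal property of free generators: every map of G into a Boolean algebra extends to a
   homomorphism.  HOL cannot quantify over the carrier type inside a definition, so the target
   algebras are those carried by sets of natural numbers.  For countable G nothing is lost, because
   the subalgebra generated by the image of G is countable, hence isomorphic to one of these.
   The lemma freely_generates_extension derives the property for all targets when G is finite. *)
definition freely_generates :: "'a::boolean_algebra set \<Rightarrow> bool" where
  "freely_generates G \<longleftrightarrow>
     generated_subalgebra G = UNIV \<and>
     (\<forall>(C :: nat set) meet join compl zero one.
        boolean_algebra_on C meet join compl zero one \<longrightarrow>
        (\<forall>g \<in> G \<rightarrow> C. \<exists>h \<in> UNIV \<rightarrow> C.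
           boolean_hom_into meet join compl zero one h \<and> (\<forall>x\<in>G. h x = g x)))"

definition normalized_measure_on :: "'a::boolean_algebra set \<Rightarrow> ('a \<Rightarrow> real) \<Rightarrow> bool" where
  "normalized_measure_on S m \<longleftrightarrow>
     (\<forall>x\<in>S. 0 \<le> m x) \<and>
     (\<forall>x\<in>S. \<forall>y\<in>S. inf x y = bot \<longrightarrow> m (sup x y) = m x + m y) \<and>
     m top = 1"

inductive ext_graph ::
    "'a::boolean_algebra set \<Rightarrow> ('a \<Rightarrow> 'b::boolean_algebra) \<Rightarrow> 'a \<Rightarrow> 'b \<Rightarrow> bool"
  for G g where
    gen: "x \<in> G \<Longrightarrow> ext_graph G g x (g x)"
  | bot: "ext_graph G g bot bot"
  | compl: "ext_graph G g x y \<Longrightarrow> ext_graph G g (- x) (- y)"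
  | inf: "ext_graph G g x y \<Longrightarrow> ext_graph G g x' y' \<Longrightarrow> ext_graph G g (inf x x') (inf y y')"

lemma ext_graph_top: "ext_graph G g top top"
  using ext_graph.compl[OF ext_graph.bot] by simp

lemma ext_graph_sup:
  assumes "ext_graph G g x y" "ext_graph G g x' y'"
  shows "ext_graph G g (sup x x') (sup y y')"
  using ext_graph.compl[OF ext_graph.inf[OF ext_graph.compl[OF assms(1)] ext_graph.compl[OF assms(2)]]]
  by simp

lemma ext_graph_total:
  assumes "generated_subalgebra G = UNIV"
  shows "\<exists>y. ext_graph G g x y"
proof -
  have "boolean_subalgebra {x. \<exists>y. ext_graph G g x y}"
    unfolding boolean_subalgebra_def
    by (auto intro: ext_graph.bot ext_graph_top ext_graph.compl ext_graph.inf ext_graph_sup)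
  moreover have "G \<subseteq> {x. \<exists>y. ext_graph G g x y}"
    by (auto intro: ext_graph.gen)
  ultimately have "generated_subalgebra G \<subseteq> {x. \<exists>y. ext_graph G g x y}"
    by (rule hull_minimal[rotated])
  then show ?thesis using assms by auto
qed

lemma deciding_element:
  fixes b :: "'b::boolean_algebra"
  assumes "finite F" "b \<noteq> bot"
  shows "\<exists>c. c \<noteq> bot \<and> c \<le> b \<and> (\<forall>x\<in>F. c \<le> x \<or> c \<le> - x)"
  using assms(1)
proof induction
  case empty
  then show ?case using assms(2) by auto
next
  case (insert x F)
  then obtain c where c: "c \<noteq> bot" "c \<le> b" "\<forall>x\<in>F. c \<le> x \<or> c \<le> - x" by blast
  show ?case
  proof (cases "inf c x = bot")
    case True
    then have "c \<le> - x" by (simp add: inf_shunt)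
    then show ?thesis using c by auto
  next
    case False
    have "\<forall>y\<in>F. inf c x \<le> y \<or> inf c x \<le> - y" using c(3) by (auto intro: le_infI1)
    then show ?thesis using c False by (intro exI[of _ "inf c x"]) (auto intro: le_infI1)
  qed
qed

lemma boolean_algebra_on_two:
  "boolean_algebra_on {0, 1::nat} min max (\<lambda>x. 1 - x) 0 1"
  by unfold_locales auto

lemma freely_generates_kernel:
  fixes g :: "'a::boolean_algebra \<Rightarrow> 'b::boolean_algebra"
  assumes free: "freely_generates G" and fin: "finite G" and "ext_graph G g bot b"
  shows "b = bot"
proof (rule ccontr)
  assume "b \<noteq> bot"
  with fin obtain c where c: "c \<noteq> bot" "c \<le> b" "\<forall>y\<in>g ` G. c \<le> y \<or> c \<le> - y"
    using deciding_element[of "g ` G" b] by auto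
  have no: "\<not> (c \<le> y \<and> c \<le> - y)" for y
    using c(1) by (metis inf.boundedI inf_compl_bot bot.extremum_unique)
  define v where "v x = (if c \<le> g x then 1 else 0 :: nat)" for x
  have "v \<in> G \<rightarrow> {0, 1}" by (auto simp: v_def)
  with free boolean_algebra_on_two obtain h :: "'a \<Rightarrow> nat" where
    hom: "boolean_hom_into min max (\<lambda>x. 1 - x) 0 1 h" and hv: "\<forall>x\<in>G. h x = v x"
    unfolding freely_generates_def by blast
  have "(c \<le> y \<or> c \<le> - y) \<and> h x = (if c \<le> y then 1 else 0)" if "ext_graph G g x y" for x y
    using that
  proof induction
    case (gen x)
    then show ?case using c(3) hv by (auto simp: v_def)
  next
    case bot
    then show ?case using hom c(1) by (auto simp: boolean_hom_into_def bot.extremum_unique)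
  next
    case (compl x y)
    then show ?case using hom no[of y] by (auto simp: boolean_hom_into_def)
  next
    case (inf x y x' y')
    then show ?case using hom by (auto simp: boolean_hom_into_def intro: le_supI1 le_supI2)
  qed
  from this[OF assms(3)] have "h bot = (if c \<le> b then 1 else 0)" by blast
  then show False using hom c(2) by (simp add: boolean_hom_into_def)
qed

lemma freely_generates_extension:
  fixes g :: "'a::boolean_algebra \<Rightarrow> 'b::boolean_algebra"
  assumes free: "freely_generates G" and fin: "finite G"
  shows "\<exists>h. boolean_hom_into inf sup uminus bot top h \<and> (\<forall>x\<in>G. h x = g x)"
proof -
  have le: "y \<le> y'" if "ext_graph G g x y" "ext_graph G g x y'" for x y y'
  proof -
    have "ext_graph G g (inf x (- x)) (inf y (- y'))"
      by (intro ext_graph.inf ext_graph.compl that)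
    then have "inf y (- y') = bot"
      using freely_generates_kernel[OF free fin] by simp
    then show ?thesis by (simp add: inf_shunt)
  qed
  have uniq: "y = y'" if "ext_graph G g x y" "ext_graph G g x y'" for x y y'
    using le[OF that] le[OF that(2,1)] by (rule order.antisym)
  have "\<forall>x. \<exists>y. ext_graph G g x y"
    using free ext_graph_total unfolding freely_generates_def by blast
  then obtain h where h: "\<And>x. ext_graph G g x (h x)" by metis
  have "boolean_hom_into inf sup uminus bot top h"
    unfolding boolean_hom_into_def
    by (intro conjI allI uniq[OF h] ext_graph.inf ext_graph_sup ext_graph.compl ext_graph.bot
        ext_graph_top h)
  moreover have "\<forall>x\<in>G. h x = g x"
    by (intro ballI uniq[OF h] ext_graph.gen)
  ultimately show ?thesis by blast
qed

end

(* Make A1 and A2 conditionally independent given A3: the atom meeting the literals l1, l2, l3 of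
   the generators gets mass f (l1 l3) * f (l2 l3) / f l3.  Summing over the two choices of l2 (or of
   l1) gives back f (l1 l3) (or f (l2 l3)), since f l3 = 0 forces f (l1 l3) = f (l2 l3) = 0.  Atoms
   are represented by the two-valued homomorphisms that freeness provides. *)
theory Submission
  imports Defs
begin

text \<open>The sign is a bool so that the value \<open>h x\<close> of a two-valued homomorphism can
  serve as the sign: \<open>literal x (h x)\<close> is whichever of \<open>x\<close> and
  \<open>- x\<close> is sent to True. Sums over both signs become sums over
  \<open>UNIV\<close>.\<close>

definition literal :: "'a::boolean_algebra \<Rightarrow> bool \<Rightarrow> 'a" where
  "literal a i = (if i then a else - a)"

abbreviation two_valued_hom :: "('a::boolean_algebra \<Rightarrow> bool) \<Rightarrow> bool" where
  "two_valued_hom \<equiv> boolean_hom_into inf sup uminus bot top"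

lemma boolean_subalgebra_generated: "boolean_subalgebra (generated_subalgebra G)"
  by (rule hull_in) (auto simp: boolean_subalgebra_def)

lemma literal_in_subalgebra:
  "boolean_subalgebra S \<Longrightarrow> a \<in> S \<Longrightarrow> literal a i \<in> S"
  by (auto simp: literal_def boolean_subalgebra_def)

lemma inf_in_subalgebra:
  "boolean_subalgebra S \<Longrightarrow> a \<in> S \<Longrightarrow> b \<in> S \<Longrightarrow> inf a b \<in> S"
  by (auto simp: boolean_subalgebra_def)

lemma generator_in_subalgebra: "a \<in> G \<Longrightarrow> a \<in> generated_subalgebra G"
  by (rule hull_inc)

lemma normalized_measure_bot:
  assumes "boolean_subalgebra S" "normalized_measure_on S f"
  shows "f bot = 0"
proof -
  have "f (sup bot bot) = f bot + f bot"
    using assms unfolding boolean_subalgebra_def normalized_measure_on_def by (metis inf.idem)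
  then show ?thesis by simp
qed

lemma normalized_measure_split:
  assumes S: "boolean_subalgebra S" and f: "normalized_measure_on S f" and "x \<in> S" "a \<in> S"
  shows "f x = (\<Sum>i\<in>UNIV. f (inf (literal a i) x))"
proof -
  have "inf a x \<in> S" "inf (- a) x \<in> S"
    using assms by (auto simp: boolean_subalgebra_def)
  moreover have "inf (inf a x) (inf (- a) x) = bot"
    by (simp add: inf.assoc inf.left_commute)
  ultimately have "f (sup (inf a x) (inf (- a) x)) = f (inf a x) + f (inf (- a) x)"
    using f unfolding normalized_measure_on_def by blast
  moreover have "sup (inf a x) (inf (- a) x) = x"
    by (simp flip: inf_sup_distrib2)
  ultimately show ?thesis by (simp add: UNIV_bool literal_def)
qed

lemma normalized_measure_mono:
  assumes "boolean_subalgebra S" "normalized_measure_on S f" "x \<in> S" "y \<in> S"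
  shows "f (inf x y) \<le> f y"
proof -
  have "0 \<le> f (inf (- x) y)"
    using assms unfolding boolean_subalgebra_def normalized_measure_on_def by blast
  then show ?thesis
    using normalized_measure_split[OF assms(1,2,4,3)] by (simp add: UNIV_bool literal_def)
qed

text \<open>The elements \<open>x\<close> with \<open>e \<le> literal x (h x)\<close> form a
  subalgebra: \<open>x\<close> and \<open>- x\<close> select the same literal, and for a meet or
  join the bounds for the two arguments combine. So deciding the generators decides everything they
  generate.\<close>

lemma two_valued_hom_decides:
  assumes h: "two_valued_hom h" and "x \<in> generated_subalgebra G"
    and e: "\<And>g. g \<in> G \<Longrightarrow> e \<le> literal g (h g)"
  shows "e \<le> literal x (h x)"
proof -
  have "boolean_subalgebra {x. e \<le> literal x (h x)}"
    using h by (auto simp: boolean_subalgebra_def boolean_hom_into_def literal_def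
        intro: le_supI1 le_supI2 le_infI1 le_infI2)
  moreover have "G \<subseteq> {x. e \<le> literal x (h x)}" using e by blast
  ultimately have "generated_subalgebra G \<subseteq> {x. e \<le> literal x (h x)}"
    by (rule hull_minimal[rotated])
  then show ?thesis using assms(2) by blast
qed

text \<open>Each cell \<open>inf (literal a i) (literal c k)\<close> lies below \<open>x\<close> or
  below \<open>- x\<close>, according to \<open>h i k x\<close>. Splitting \<open>x\<close> along
  \<open>c\<close> and then along \<open>a\<close> therefore yields only whole cells and
  \<open>bot\<close>.\<close>

lemma two_generated_measure_eq:
  fixes h :: "bool \<Rightarrow> bool \<Rightarrow> 'a::boolean_algebra \<Rightarrow> bool"
  assumes f: "normalized_measure_on (generated_subalgebra {a, c}) f"
    and h: "\<And>i k. two_valued_hom (h i k)" "\<And>i k. h i k a = i" "\<And>i k. h i k c = k"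
    and x: "x \<in> generated_subalgebra {a, c}"
  shows "f x = (\<Sum>i\<in>UNIV. \<Sum>k\<in>UNIV. of_bool (h i k x) * f (inf (literal a i) (literal c k)))"
proof -
  let ?S = "generated_subalgebra {a, c}"
  have S: "boolean_subalgebra ?S" by (rule boolean_subalgebra_generated)
  have gen: "a \<in> ?S" "c \<in> ?S" by (auto intro: generator_in_subalgebra)
  have cell: "f (inf (literal a i) (inf (literal c k) x))
      = of_bool (h i k x) * f (inf (literal a i) (literal c k))" for i k
  proof -
    let ?e = "inf (literal a i) (literal c k)"
    have "?e \<le> literal x (h i k x)"
      by (rule two_valued_hom_decides[OF h(1) x]) (auto simp: h)
    then have "inf ?e x = (if h i k x then ?e else bot)"
      by (auto simp: literal_def inf_absorb1 inf_shunt)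
    then show ?thesis
      using normalized_measure_bot[OF S f] by (simp add: inf.assoc)
  qed
  have "f x = (\<Sum>k\<in>UNIV. f (inf (literal c k) x))"
    by (rule normalized_measure_split[OF S f x gen(2)])
  also have "\<dots> = (\<Sum>k\<in>UNIV. \<Sum>i\<in>UNIV. f (inf (literal a i) (inf (literal c k) x)))"
    by (intro sum.cong refl normalized_measure_split[OF S f] inf_in_subalgebra[OF S]
        literal_in_subalgebra[OF S] x gen)
  also have "\<dots> = (\<Sum>i\<in>UNIV. \<Sum>k\<in>UNIV. of_bool (h i k x) * f (inf (literal a i) (literal c k)))"
    unfolding cell by (rule sum.swap)
  finally show ?thesis .
qed

text \<open>In probabilistic terms this is P(l1 | l3) P(l2 | l3) P(l3).\<close>

definition cond_indep_weight ::
    "('a::boolean_algebra \<Rightarrow> real) \<Rightarrow> 'a \<Rightarrow> 'a \<Rightarrow> 'a \<Rightarrow> real" where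
  "cond_indep_weight f l1 l2 l3 = f (inf l1 l3) * f (inf l2 l3) / f l3"

lemma cond_indep_weight_commute: "cond_indep_weight f l1 l2 l3 = cond_indep_weight f l2 l1 l3"
  by (simp add: cond_indep_weight_def)

lemma cond_indep_weight_marginal:
  assumes fac: "normalized_measure_on (generated_subalgebra {a, c}) f"
    and fbc: "normalized_measure_on (generated_subalgebra {b, c}) f"
  shows "(\<Sum>j\<in>UNIV. cond_indep_weight f (literal a i) (literal b j) (literal c k))
    = f (inf (literal a i) (literal c k))"
proof -
  have in_S: "literal x i \<in> generated_subalgebra {x, y}" "literal y i \<in> generated_subalgebra {x, y}"
    for x y :: 'a and i
    by (auto intro: generator_in_subalgebra literal_in_subalgebra boolean_subalgebra_generated)
  have sum: "(\<Sum>j\<in>UNIV. f (inf (literal b j) (literal c k))) = f (literal c k)"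
    by (rule normalized_measure_split[OF boolean_subalgebra_generated fbc, symmetric])
      (auto intro: in_S generator_in_subalgebra)
  have "0 \<le> f (inf (literal a i) (literal c k))"
    using fac inf_in_subalgebra[OF boolean_subalgebra_generated in_S]
    unfolding normalized_measure_on_def by blast
  moreover have "f (inf (literal a i) (literal c k)) \<le> f (literal c k)"
    by (rule normalized_measure_mono[OF boolean_subalgebra_generated fac in_S])
  \<comment> \<open>Division by zero yields 0, so over a null \<open>literal c k\<close> all weights
    vanish and the right-hand side has to vanish as well.\<close>
  ultimately have "f (literal c k) = 0 \<Longrightarrow> f (inf (literal a i) (literal c k)) = 0" by simp
  then show ?thesis
    unfolding cond_indep_weight_def
    by (simp add: sum flip: sum_divide_distrib sum_distrib_left)
qed

text \<open>For \<open>x\<close> generated by \<open>a\<close> and \<open>c\<close>,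
  \<open>h i j k x\<close> does not depend on \<open>j\<close>, so the sum over \<open>j\<close>
  reaches only the weights and gives their marginal. The generators are kept arbitrary so that the
  roles of \<open>A1\<close> and \<open>A2\<close> can be exchanged.\<close>

lemma cond_indep_extends:
  fixes h :: "bool \<Rightarrow> bool \<Rightarrow> bool \<Rightarrow> 'a::boolean_algebra \<Rightarrow> bool"
  assumes fac: "normalized_measure_on (generated_subalgebra {a, c}) f"
    and fbc: "normalized_measure_on (generated_subalgebra {b, c}) f"
    and h: "\<And>i j k. two_valued_hom (h i j k)"
      "\<And>i j k. h i j k a = i" "\<And>i j k. h i j k c = k"
    and x: "x \<in> generated_subalgebra {a, c}"
  shows "(\<Sum>i\<in>UNIV. \<Sum>j\<in>UNIV. \<Sum>k\<in>UNIV. of_bool (h i j k x) *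
      cond_indep_weight f (literal a i) (literal b j) (literal c k)) = f x"
proof -
  have indep: "h i j k x = h i True k x" for i j k
  proof -
    \<comment> \<open>Two homomorphisms agree on a subalgebra, and these two agree at
      \<open>a\<close> and \<open>c\<close>. The value True for \<open>j\<close> is an arbitrary
      representative.\<close>
    have "boolean_subalgebra {x. h i j k x = h i True k x}"
      using h(1) by (auto simp: boolean_subalgebra_def boolean_hom_into_def)
    moreover have "{a, c} \<subseteq> {x. h i j k x = h i True k x}" by (simp add: h)
    ultimately have "generated_subalgebra {a, c} \<subseteq> {x. h i j k x = h i True k x}"
      by (rule hull_minimal[rotated])
    then show ?thesis using x by blast
  qed
  have "(\<Sum>i\<in>UNIV. \<Sum>j\<in>UNIV. \<Sum>k\<in>UNIV. of_bool (h i j k x) *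
      cond_indep_weight f (literal a i) (literal b j) (literal c k))
    = (\<Sum>i\<in>UNIV. \<Sum>j\<in>UNIV. \<Sum>k\<in>UNIV. of_bool (h i True k x) *
      cond_indep_weight f (literal a i) (literal b j) (literal c k))"
    by (subst indep) (rule refl)
  also have "\<dots> = (\<Sum>i\<in>UNIV. \<Sum>k\<in>UNIV. \<Sum>j\<in>UNIV. of_bool (h i True k x) *
      cond_indep_weight f (literal a i) (literal b j) (literal c k))"
    by (intro sum.cong refl sum.swap)
  also have "\<dots> = (\<Sum>i\<in>UNIV. \<Sum>k\<in>UNIV. of_bool (h i True k x) * f (inf (literal a i) (literal c k)))"
    by (simp only: cond_indep_weight_marginal[OF fac fbc] flip: sum_distrib_left)
  also have "\<dots> = f x"
    by (rule two_generated_measure_eq[OF fac _ _ _ x, symmetric]) (rule h)+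
  finally show ?thesis .
qed

theorem mainTheorem3:
  fixes A1 A2 A3 :: "'a::boolean_algebra"
    and f :: "'a \<Rightarrow> real"
  assumes "freely_generates {A1, A2, A3}"
    and "f \<in> generated_subalgebra {A1, A3} \<union> generated_subalgebra {A2, A3} \<rightarrow> {0..1}"
    and "normalized_measure_on (generated_subalgebra {A1, A3}) f"
    and "normalized_measure_on (generated_subalgebra {A2, A3}) f"
  shows "\<exists>\<mu> :: 'a \<Rightarrow> real. normalized_measure_on UNIV \<mu> \<and>
           (\<forall>x \<in> generated_subalgebra {A1, A3} \<union> generated_subalgebra {A2, A3}. \<mu> x = f x)"
proof (cases "distinct [A1, A2, A3]")
  case False
  \<comment> \<open>If two generators coincide, one of the two subalgebras is already the whole
    algebra and \<open>f\<close> itself is the required measure.\<close>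
  then have "{A1, A2, A3} = {A1, A3} \<or> {A1, A2, A3} = {A2, A3}" by auto
  then have "normalized_measure_on UNIV f"
    using assms(1,3,4) unfolding freely_generates_def by metis
  then show ?thesis by blast
next
  case True
  \<comment> \<open>Since the generators are distinct, every sign pattern \<open>i j k\<close> is
    realised by such a map; freeness turns the eight maps into homomorphisms.\<close>
  let ?g = "\<lambda>i j k x. if x = A1 then i else if x = A2 then j else (k :: bool)"
  have "\<exists>h. two_valued_hom h \<and> (\<forall>x\<in>{A1, A2, A3}. h x = ?g i j k x)" for i j k
    by (rule freely_generates_extension[OF assms(1)]) simp
  then obtain h where hom: "\<And>i j k. two_valued_hom (h i j k)"
    and hg: "\<And>i j k. \<forall>x\<in>{A1, A2, A3}. h i j k x = ?g i j k x" by metis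
  have h: "h i j k A1 = i" "h i j k A2 = j" "h i j k A3 = k" for i j k
    using hg[of i j k] True by auto
  define w where
    "w i j k = cond_indep_weight f (literal A1 i) (literal A2 j) (literal A3 k)" for i j k
  \<comment> \<open>\<open>h i j k x\<close> tells whether the atom with signs \<open>i j k\<close>
    lies below \<open>x\<close>, so this adds up the masses of the atoms below
    \<open>x\<close>.\<close>
  define \<mu> where "\<mu> x = (\<Sum>i\<in>UNIV. \<Sum>j\<in>UNIV. \<Sum>k\<in>UNIV. of_bool (h i j k x) * w i j k)" for x
  have eq13: "\<mu> x = f x" if "x \<in> generated_subalgebra {A1, A3}" for x
    unfolding \<mu>_def w_def by (rule cond_indep_extends[OF assms(3,4) hom h(1,3) that])
  have eq23: "\<mu> x = f x" if "x \<in> generated_subalgebra {A2, A3}" for x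
  proof -
    \<comment> \<open>The weight is symmetric in its first two literals, so exchanging the two outer
      sums gives the situation of \<open>cond_indep_extends\<close> with \<open>A1\<close> and
      \<open>A2\<close> exchanged.\<close>
    have "\<mu> x = (\<Sum>j\<in>UNIV. \<Sum>i\<in>UNIV. \<Sum>k\<in>UNIV. of_bool (h i j k x) *
        cond_indep_weight f (literal A2 j) (literal A1 i) (literal A3 k))"
      unfolding \<mu>_def w_def by (subst cond_indep_weight_commute) (rule sum.swap)
    also have "\<dots> = f x"
      by (rule cond_indep_extends[OF assms(4,3) hom h(2,3) that])
    finally show ?thesis .
  qed
  have lit: "literal x i \<in> generated_subalgebra {x, A3}"
    "literal A3 i \<in> generated_subalgebra {x, A3}" for x i
    by (auto intro: generator_in_subalgebra literal_in_subalgebra boolean_subalgebra_generated)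
  have "0 \<le> w i j k" for i j k
    unfolding w_def cond_indep_weight_def
    using assms(3,4) lit inf_in_subalgebra[OF boolean_subalgebra_generated lit]
    unfolding normalized_measure_on_def by (intro divide_nonneg_nonneg mult_nonneg_nonneg) blast+
  then have "0 \<le> \<mu> x" for x
    unfolding \<mu>_def by (intro sum_nonneg mult_nonneg_nonneg) auto
  moreover have "\<mu> (sup x y) = \<mu> x + \<mu> y" if "inf x y = bot" for x y
  proof -
    \<comment> \<open>Disjoint elements cannot both be sent to True, since their meet
      \<open>bot\<close> goes to False; hence each summand is additive.\<close>
    have "\<not> (h i j k x \<and> h i j k y)" for i j k
      using hom[of i j k] that unfolding boolean_hom_into_def by (metis inf_bool_def bot_bool_def)
    then have "of_bool (h i j k (sup x y)) = of_bool (h i j k x) + (of_bool (h i j k y) :: real)"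
      for i j k
      using hom[of i j k] unfolding boolean_hom_into_def by auto
    then show ?thesis
      unfolding \<mu>_def by (simp add: distrib_right sum.distrib)
  qed
  \<comment> \<open>The total mass needs no summation: \<open>top\<close> lies in the first
    subalgebra, where \<mu> agrees with \<open>f\<close>.\<close>
  moreover have "\<mu> top = 1"
    using eq13[of top] assms(3) boolean_subalgebra_generated[of "{A1, A3}"]
    by (simp add: normalized_measure_on_def boolean_subalgebra_def)
  ultimately have "normalized_measure_on UNIV \<mu>"
    by (simp add: normalized_measure_on_def)
  then show ?thesis using eq13 eq23 by blast
qed

end
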